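(* Let $k,l$ be positive integers, let $a_1,\ldots,a_k,b_1,\ldots,b_l\in\mathbb{Z}$, and let $n_1,\ldots,n_k\in\mathbb{Z}^+$ be pairwise distinct and $m_1,\ldots,m_l\in\mathbb{Z}^+$ be pairwise distinct. Let $A=\{a_s(n_s)\}_{s=1}^k$ and $B=\{b_t(m_t)\}_{t=1}^l$, with covering functions $w_A(x)=|\{1\leqslant s\leqslant k: x\equiv a_s\ (\mathrm{mod}\ n_s)\}|$ and $w_B(x)=|\{1\leqslant t\leqslant l: x\equiv b_t\ (\mathrm{mod}\ m_t)\}|$. Let $N=[n_1,\ldots,n_k,m_1,\ldots,m_l]$ be the least common multiple of all these moduli, and let $m$ be an integer that does not divide $N$. If $w_A(x)\equiv w_B(x)\ (\mathrm{mod}\ m)$ for all $x\in\mathbb{Z}$, then $A$ and $B$ are identical, i.e., $k=l$ and $\{a_s(n_s): 1\leqslant s\leqslant k\}=\{b_t(m_t):1\leqslant t\leqslant l\}$ as sets of residue classes.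
   Context: For $a\in\mathbb{Z}$ and $n\in\mathbb{Z}^+$, $a(n)$ denotes the residue class $\{x\in\mathbb{Z}: x\equiv a\ (\mathrm{mod}\ n)\}$. A congruence modulo $0$ means equality (so $m=0$ is allowed, as $0$ does not divide $N$). *)

theory Defs
  imports "HOL-Number_Theory.Cong"
begin

definition residue_class :: "int \<Rightarrow> int \<Rightarrow> int set" where
  "residue_class a n = {x. [x = a] (mod n)}"

text \<open>
  A finite system of residue classes is given by its length \<open>k\<close>, the residues \<open>a 1, \<dots>, a k\<close>
  and the moduli \<open>n 1, \<dots>, n k\<close>; values of \<open>a\<close> and \<open>n\<close> at other indices are irrelevant.
\<close>

definition covering_function :: "nat \<Rightarrow> (nat \<Rightarrow> int) \<Rightarrow> (nat \<Rightarrow> int) \<Rightarrow> int \<Rightarrow> nat" where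
  "covering_function k a n x = card {s \<in> {1..k}. [x = a s] (mod n s)}"

definition class_set :: "nat \<Rightarrow> (nat \<Rightarrow> int) \<Rightarrow> (nat \<Rightarrow> int) \<Rightarrow> int set set" where
  "class_set k a n = (\<lambda>s. residue_class (a s) (n s)) ` {1..k}"

end

theory Submission
  imports Defs
begin

text \<open>
  Reduce both systems to sets of pairs (modulus, residue), and let \<open>d\<close> be the largest modulus at
  which they differ. There is a \<open>d\<close>-periodic integer function \<open>P\<close> with \<open>P 0 = 1\<close> that is orthogonal
  to every function with a period not divisible by \<open>d\<close> (an integral substitute for the primitive
  additive characters modulo \<open>d\<close>). Pairing the difference of the covering functions with the
  translates of \<open>P\<close> leaves only the classes modulo \<open>d\<close>. If only one system contains such a class,
  the given modulus divides \<open>N div d\<close>. If the two classes differ by \<open>c\<close>, then \<open>N div d * P\<close> is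
  \<open>c\<close>-periodic, hence \<open>g\<close>-periodic with \<open>g = gcd c d\<close>, up to the given modulus; as \<open>P\<close> is
  orthogonal to the indicator of the multiples of \<open>g\<close>, the modulus divides \<open>N div g\<close>.
\<close>

section \<open>Periodic functions and counting in residue classes\<close>

definition periodic :: "int \<Rightarrow> (int \<Rightarrow> 'a) \<Rightarrow> bool" where
  "periodic n f \<longleftrightarrow> (\<forall>x y. [x = y] (mod n) \<longrightarrow> f x = f y)"

lemma periodicD: "periodic n f \<Longrightarrow> [x = y] (mod n) \<Longrightarrow> f x = f y"
  by (auto simp: periodic_def)

lemma periodic_dvd: "periodic n f \<Longrightarrow> n dvd k \<Longrightarrow> periodic k f"
  by (auto simp: periodic_def intro: cong_dvd_modulus)

lemma periodic_shift: "periodic n f \<Longrightarrow> periodic n (\<lambda>x. f (x + u))"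
  by (simp add: periodic_def cong_add_rcancel)

lemma periodic_mult: "periodic n f \<Longrightarrow> periodic n g \<Longrightarrow> periodic n (\<lambda>x. f x * g x)"
  by (auto simp: periodic_def intro!: arg_cong2[where f = "(*)"])

lemma periodic_residue_class: "periodic n (\<lambda>x. of_bool ([x = a] (mod n)))"
  by (auto simp: periodic_def cong_def)

lemma sum_periodic_shift:
  fixes f :: "int \<Rightarrow> int"
  assumes "periodic n f" and "n > 0"
  shows "(\<Sum>x\<in>{0..<n}. f (x + u)) = (\<Sum>x\<in>{0..<n}. f x)"
proof (rule sum.reindex_bij_witness[where i = "\<lambda>x. (x - u) mod n" and j = "\<lambda>x. (x + u) mod n"])
  fix x assume "x \<in> {0..<n}"
  then show "((x + u) mod n - u) mod n = x" "((x - u) mod n + u) mod n = x"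
    by (simp_all add: mod_simps)
  show "f ((x + u) mod n) = f (x + u)"
    using assms(1) by (rule periodicD) (simp add: cong_def)
qed (use assms(2) in auto)

lemma count_residue_class:
  fixes n N :: int
  assumes "n > 0" and "N > 0" and "n dvd N"
  shows "(\<Sum>x\<in>{0..<N}. of_bool ([x = a] (mod n))) = N div n"
proof -
  let ?f = "\<lambda>x. of_bool ([x = a] (mod n)) :: int"
  have "periodic N ?f"
    using periodic_dvd[OF periodic_residue_class assms(3)] .
  then have "(\<Sum>x\<in>{0..<N}. ?f x) = (\<Sum>x\<in>{0..<N}. ?f (x + a))"
    using sum_periodic_shift[symmetric] assms(2) by blast
  also have "\<dots> = (\<Sum>x\<in>{0..<N}. of_bool (n dvd x))"
    by (simp add: cong_iff_dvd_diff)
  also have "\<dots> = int (card {x\<in>{0..<N}. n dvd x})"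
    by (simp flip: sum.inter_filter add: of_bool_def)
  also have "{x\<in>{0..<N}. n dvd x} = (\<lambda>j. n * j) ` {0..<N div n}"
  proof -
    obtain e where e: "N = n * e" using assms(3) by auto
    show ?thesis using assms(1) unfolding e
      by (auto simp: zero_le_mult_iff elim!: dvdE)
  qed
  also have "card \<dots> = nat (N div n)"
    using assms(1) by (subst card_image) (auto simp: inj_on_def)
  also have "int \<dots> = N div n"
    using assms by (simp add: pos_imp_zdiv_nonneg_iff)
  finally show ?thesis .
qed

section \<open>The test function modulo \<open>d\<close> and its orthogonality\<close>

text \<open>
  The factor at a prime \<open>p\<close> takes the values \<open>1\<close>, \<open>-1\<close> and \<open>0\<close> and depends on \<open>x\<close> only modulo the
  full power of \<open>p\<close> in \<open>d\<close>; the translation by \<open>d div p\<close> leaves all the other factors fixed.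
\<close>

lemma test_function_exists:
  fixes d :: int
  assumes "d > 0"
  obtains P :: "int \<Rightarrow> int" where "periodic d P" and "P 0 = 1"
    and "\<And>p x. prime p \<Longrightarrow> p dvd d \<Longrightarrow> (\<Sum>j\<in>{0..<p}. P (x + j * (d div p))) = 0"
proof -
  define q where "q p = p ^ multiplicity p d" for p
  \<comment> \<open>The indicator of the multiples of \<open>q p\<close> minus its translate by
    \<open>d div p\<close>, so that sums over translates by multiples of \<open>d div p\<close>
    telescope.\<close>
  define h where "h p x = (of_bool (q p dvd x) - of_bool (q p dvd x + d div p) :: int)" for p x
  define P where "P x = (\<Prod>p\<in>prime_factors d. h p x)" for x
  have q_dvd: "q p dvd d" for p
    by (simp add: q_def multiplicity_dvd)
  have h_cong: "h p x = h p y" if "[x = y] (mod q p)" for p x y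
  proof -
    have "q p dvd x \<longleftrightarrow> q p dvd y"
      using that by (rule cong_dvd_iff)
    moreover have "q p dvd x + d div p \<longleftrightarrow> q p dvd y + d div p"
      using that by (meson cong_add cong_refl cong_dvd_iff)
    ultimately show ?thesis by (simp add: h_def)
  qed
  have "periodic d P"
    unfolding periodic_def P_def
    by (intro allI impI prod.cong refl h_cong) (rule cong_dvd_modulus[OF _ q_dvd])
  moreover have "P 0 = 1"
  proof -
    have "h p 0 = 1" if "p \<in> prime_factors d" for p
    proof -
      have p: "prime p" "p dvd d" using that by auto
      \<comment> \<open>Otherwise \<open>p\<close> would divide \<open>d\<close> to a power above
        its multiplicity. Hence the second indicator in \<open>h p\<close> vanishes at
        \<open>0\<close>.\<close>
      have "\<not> q p dvd d div p"
      proof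
        assume "q p dvd d div p"
        then have "p * q p dvd p * (d div p)" by simp
        then have "p ^ Suc (multiplicity p d) dvd d"
          using p by (simp add: q_def)
        then show False
          using p assms by (metis multiplicity_geI not_less_eq_eq order_refl
              less_irrefl not_prime_unit)
      qed
      then show ?thesis by (simp add: h_def)
    qed
    then show ?thesis by (simp add: P_def)
  qed
  moreover have "(\<Sum>j\<in>{0..<p}. P (x + j * (d div p))) = 0" if p: "prime p" "p dvd d" for p x
  proof -
    let ?g = "\<lambda>j. of_bool (q p dvd x + j * (d div p)) :: int"
    have pf: "p \<in> prime_factors d" using p assms by (auto simp: prime_factors_dvd)
    have h_fixed: "h r (x + j * (d div p)) = h r x" if r: "r \<in> prime_factors d - {p}" for r j
    proof -
      have rp: "prime r" "r \<noteq> p" using r by auto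
      have "coprime (q r) p"
        using rp p(1) by (simp add: q_def primes_coprime)
      moreover have "q r dvd p * (d div p)" using q_dvd p(2) by simp
      ultimately have "q r dvd d div p" by (simp add: coprime_dvd_mult_right_iff)
      then show ?thesis by (intro h_cong) (simp add: cong_iff_dvd_diff)
    qed
    \<comment> \<open>Raising \<open>j\<close> by \<open>p\<close> adds \<open>d\<close>, a multiple
      of \<open>q p\<close>, so the telescoping sum closes up cyclically.\<close>
    have "periodic p ?g"
      unfolding periodic_def
    proof (intro allI impI)
      fix i j :: int assume "[i = j] (mod p)"
      then have "p * (d div p) dvd (i - j) * (d div p)"
        by (simp add: cong_iff_dvd_diff mult_dvd_mono)
      then have "q p dvd (x + i * (d div p)) - (x + j * (d div p))"
        using p(2) q_dvd[of p] by (simp add: algebra_simps) (meson dvd_trans)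
      then show "?g i = ?g j"
        using cong_dvd_iff[of "x + i * (d div p)" "x + j * (d div p)" "q p"]
        by (simp add: cong_iff_dvd_diff)
    qed
    then have shift: "(\<Sum>j\<in>{0..<p}. ?g (j + 1)) = (\<Sum>j\<in>{0..<p}. ?g j)"
      using sum_periodic_shift p(1) prime_gt_0_int by blast
    have "P (x + j * (d div p)) = (\<Prod>r\<in>prime_factors d - {p}. h r x) * (?g j - ?g (j + 1))" for j
    proof -
      have "P (x + j * (d div p)) = h p (x + j * (d div p)) *
          (\<Prod>r\<in>prime_factors d - {p}. h r (x + j * (d div p)))"
        unfolding P_def by (rule prod.remove) (use pf in auto)
      also have "(\<Prod>r\<in>prime_factors d - {p}. h r (x + j * (d div p)))
          = (\<Prod>r\<in>prime_factors d - {p}. h r x)"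
        using h_fixed by (rule prod.cong[OF refl])
      also have "h p (x + j * (d div p)) = ?g j - ?g (j + 1)"
        by (simp add: h_def algebra_simps)
      finally show ?thesis by (simp add: mult.commute)
    qed
    then show ?thesis
      using shift by (simp flip: sum_distrib_left add: sum_subtractf)
  qed
  ultimately show thesis using that by blast
qed

text \<open>By Bezout the multiples of \<open>e\<close> cover, modulo \<open>d\<close>, all
  multiples of \<open>gcd d e\<close>, and \<open>d div p\<close> is one of these as soon as
  \<open>p\<close> divides the non-unit \<open>d div gcd d e\<close>. Such a \<open>u\<close> is a
  period of every \<open>e\<close>-periodic function.\<close>

lemma prime_translation:
  fixes d e :: int
  assumes "d > 0" and "\<not> d dvd e"
  obtains p u where "prime p" and "p dvd d" and "e dvd u" and "[u = d div p] (mod d)"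
proof -
  define g where "g = gcd d e"
  have "g dvd d" by (simp add: g_def)
  then obtain f where f: "d = g * f" by (rule dvdE)
  have "\<not> is_unit f"
  proof
    assume "is_unit f"
    then have "d dvd g" using f by simp
    then show False using assms(2) by (simp add: g_def)
  qed
  moreover have "f \<noteq> 0" using f assms(1) by auto
  ultimately obtain p where p: "prime p" "p dvd f"
    using prime_divisor_exists by blast
  obtain w where w: "f = p * w" using p(2) by auto
  have pd: "p dvd d" using p(2) f by simp
  have dp: "d div p = g * w"
    using p(1) unfolding f w by (simp add: mult.left_commute[of g])
  obtain r s where rs: "r * d + s * e = g" using bezout_int g_def by blast
  have "[s * e * w = d div p] (mod d)"
  proof -
    have "d div p - s * e * w = r * d * w" unfolding dp rs[symmetric] by (simp add: algebra_simps)
    then have "d dvd d div p - s * e * w" by simp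
    then show ?thesis by (simp add: cong_iff_dvd_diff dvd_diff_commute)
  qed
  moreover have "e dvd s * e * w" by simp
  ultimately show thesis using that p(1) pd by blast
qed

text \<open>Translating by \<open>j * u\<close> fixes \<open>c\<close> and moves \<open>P\<close> by \<open>j * (d div p)\<close>; averaging over \<open>j\<close> kills \<open>P\<close>.\<close>

lemma test_function_orthogonal:
  fixes P c :: "int \<Rightarrow> int" and d e N z :: int
  assumes P: "periodic d P"
    and P0: "\<And>p x. prime p \<Longrightarrow> p dvd d \<Longrightarrow> (\<Sum>j\<in>{0..<p}. P (x + j * (d div p))) = 0"
    and c: "periodic e c" and "d > 0" and "N > 0" and "d dvd N" and "e dvd N" and "\<not> d dvd e"
  shows "(\<Sum>x\<in>{0..<N}. c x * P (x - z)) = 0"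
proof -
  obtain p u where pu: "prime p" "p dvd d" "e dvd u" "[u = d div p] (mod d)"
    using prime_translation assms(4,8) by blast
  let ?L = "\<Sum>x\<in>{0..<N}. c x * P (x - z)"
  have "periodic N (\<lambda>x. c x * P (x - z))"
    using periodic_mult[OF periodic_dvd[OF c assms(7)]
        periodic_shift[OF periodic_dvd[OF P assms(6)], of "- z"]] by simp
  have "?L = (\<Sum>x\<in>{0..<N}. c x * P ((x - z) + j * (d div p)))" for j
  proof -
    have "?L = (\<Sum>x\<in>{0..<N}. c (x + j * u) * P (x + j * u - z))"
      using sum_periodic_shift[OF \<open>periodic N _\<close> assms(5), of "j * u"] by simp
    also have "\<dots> = (\<Sum>x\<in>{0..<N}. c x * P ((x - z) + j * (d div p)))"
    proof (rule sum.cong[OF refl])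
      fix x
      have "c (x + j * u) = c x"
        using c by (rule periodicD) (use pu(3) in \<open>simp add: cong_iff_dvd_diff\<close>)
      moreover have "P (x + j * u - z) = P ((x - z) + j * (d div p))"
        using P
      proof (rule periodicD)
        have "[(x - z) + j * u = (x - z) + j * (d div p)] (mod d)"
          using pu(4) by (intro cong_add cong_mult cong_refl)
        then show "[x + j * u - z = (x - z) + j * (d div p)] (mod d)"
          by (simp add: algebra_simps)
      qed
      ultimately show "c (x + j * u) * P (x + j * u - z) = c x * P ((x - z) + j * (d div p))"
        by simp
    qed
    finally show ?thesis .
  qed
  then have "(\<Sum>j\<in>{0..<p}. ?L) = (\<Sum>j\<in>{0..<p}. \<Sum>x\<in>{0..<N}. c x * P ((x - z) + j * (d div p)))"
    by (rule sum.cong[OF refl])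
  also have "\<dots> = (\<Sum>x\<in>{0..<N}. c x * (\<Sum>j\<in>{0..<p}. P ((x - z) + j * (d div p))))"
    by (subst sum.swap) (simp add: sum_distrib_left)
  also have "\<dots> = 0" using P0 pu(1,2) by simp
  finally show ?thesis using pu(1) prime_gt_0_int[of p] by simp
qed

text \<open>\<open>P (x - z)\<close> is constant on the class, so only the size of the class
  matters.\<close>

lemma sum_residue_class_mult:
  fixes P :: "int \<Rightarrow> int"
  assumes P: "periodic d P" and "d > 0" and "N > 0" and "d dvd N"
  shows "(\<Sum>x\<in>{0..<N}. of_bool ([x = r] (mod d)) * P (x - z)) = N div d * P (r - z)"
proof -
  have "of_bool ([x = r] (mod d)) * P (x - z) = of_bool ([x = r] (mod d)) * P (r - z)" for x
    using periodicD[OF P, of "x - z" "r - z"] cong_diff[OF _ cong_refl] by auto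
  then have "(\<Sum>x\<in>{0..<N}. of_bool ([x = r] (mod d)) * P (x - z))
      = (\<Sum>x\<in>{0..<N}. of_bool ([x = r] (mod d))) * P (r - z)"
    by (simp only: sum_distrib_right)
  then show ?thesis
    using count_residue_class[OF assms(2-4)] by simp
qed

section \<open>Periods up to congruence\<close>

lemma cong_period_mult:
  fixes Q :: "int \<Rightarrow> int"
  assumes "\<And>y. [Q (y + c) = Q y] (mod m)"
  shows "[Q (y + r * c) = Q y] (mod m)"
proof (induction r rule: int_induct[where k = 0])
  case base
  show ?case by simp
next
  case (step1 i)
  have "[Q (y + (i + 1) * c) = Q (y + i * c)] (mod m)"
    using assms[of "y + i * c"] by (simp add: algebra_simps)
  then show ?case using step1(2) cong_trans by blast
next
  case (step2 i)
  have "[Q (y + (i - 1) * c) = Q (y + i * c)] (mod m)"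
    using cong_sym[OF assms[of "y + (i - 1) * c"]] by (simp add: algebra_simps)
  then show ?case using step2(2) cong_trans by blast
qed

text \<open>By Bezout a multiple of \<open>gcd c d\<close> is a multiple of \<open>c\<close>, a
  period modulo \<open>m\<close>, plus a multiple of \<open>d\<close>, an exact period.\<close>

lemma cong_period_gcd:
  fixes Q :: "int \<Rightarrow> int"
  assumes "\<And>y. [Q (y + c) = Q y] (mod m)" and "periodic d Q" and "gcd c d dvd x"
  shows "[Q x = Q 0] (mod m)"
proof -
  obtain r s where rs: "r * c + s * d = gcd c d" using bezout_int by blast
  obtain w where "x = gcd c d * w" using assms(3) by auto
  then have x: "x = 0 + (r * w) * c + (s * w) * d"
    unfolding rs[symmetric] by (simp add: algebra_simps)
  have "Q x = Q (0 + (r * w) * c)"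
    using assms(2) by (rule periodicD) (subst x, simp add: cong_iff_dvd_diff)
  then show ?thesis using cong_period_mult[of Q, OF assms(1)] by metis
qed

section \<open>Systems as sets of pairs (modulus, residue)\<close>

definition pair_count :: "(int \<times> int) set \<Rightarrow> int \<Rightarrow> int" where
  "pair_count R x = (\<Sum>q\<in>R. of_bool ([x = snd q] (mod fst q)))"

text \<open>Injectivity of \<open>fst\<close> says that the moduli are distinct; normalised residues
  make equal classes equal pairs, so that set differences compare systems faithfully.\<close>

definition class_pairs :: "int \<Rightarrow> (int \<times> int) set \<Rightarrow> bool" where
  "class_pairs N R \<longleftrightarrow> finite R \<and> inj_on fst R \<and>
     (\<forall>q\<in>R. fst q > 0 \<and> fst q dvd N \<and> 0 \<le> snd q \<and> snd q < fst q)"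

lemma class_pairs_subset: "class_pairs N R \<Longrightarrow> S \<subseteq> R \<Longrightarrow> class_pairs N S"
  by (auto simp: class_pairs_def intro: finite_subset inj_on_subset)

text \<open>A positive modulus below \<open>d\<close> is not divisible by \<open>d\<close>, so its
  class is orthogonal to \<open>P\<close>. The surviving sum has at most one term; written as a sum
  it covers both cases.\<close>

lemma pair_count_test_function:
  assumes R: "class_pairs N R" and le: "\<And>q. q \<in> R \<Longrightarrow> fst q \<le> d"
    and P: "periodic d P"
    and P0: "\<And>p x. prime p \<Longrightarrow> p dvd d \<Longrightarrow> (\<Sum>j\<in>{0..<p}. P (x + j * (d div p))) = 0"
    and "d > 0" and "N > 0" and "d dvd N"
  shows "(\<Sum>x\<in>{0..<N}. pair_count R x * P (x - z))
    = (\<Sum>q\<in>{q\<in>R. fst q = d}. N div d * P (snd q - z))"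
proof -
  have "(\<Sum>x\<in>{0..<N}. pair_count R x * P (x - z))
      = (\<Sum>q\<in>R. \<Sum>x\<in>{0..<N}. of_bool ([x = snd q] (mod fst q)) * P (x - z))"
    unfolding pair_count_def sum_distrib_right by (rule sum.swap)
  also have "\<dots> = (\<Sum>q\<in>R. if fst q = d then N div d * P (snd q - z) else 0)"
  proof (rule sum.cong[OF refl])
    fix q assume q: "q \<in> R"
    have "(\<Sum>x\<in>{0..<N}. of_bool ([x = snd q] (mod fst q)) * P (x - z)) = 0" if "fst q \<noteq> d"
    proof (rule test_function_orthogonal[OF P P0 periodic_residue_class assms(5-7)])
      show "fst q dvd N" using R q by (simp add: class_pairs_def)
      show "\<not> d dvd fst q"
        using zdvd_not_zless[of "fst q" d] R q le[OF q] that
        by (simp add: class_pairs_def)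
    qed
    then show "(\<Sum>x\<in>{0..<N}. of_bool ([x = snd q] (mod fst q)) * P (x - z))
        = (if fst q = d then N div d * P (snd q - z) else 0)"
      using sum_residue_class_mult[OF P assms(5-7)] by auto
  qed
  also have "\<dots> = (\<Sum>q\<in>{q\<in>R. fst q = d}. N div d * P (snd q - z))"
    using R by (simp add: class_pairs_def sum.inter_filter)
  finally show ?thesis .
qed

lemma class_pairs_eq_modulus:
  assumes "class_pairs N R" and "q \<in> R"
  shows "{q'\<in>R. fst q' = fst q} = {q}"
  using assms by (auto simp: class_pairs_def dest: inj_onD)

text \<open>Common classes cancel, so the largest modulus of disagreement becomes the largest one
  present.\<close>

lemma pair_count_diff:
  assumes "finite R" and "finite S"
  shows "pair_count R x - pair_count S x = pair_count (R - S) x - pair_count (S - R) x"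
proof -
  have "pair_count R x = pair_count (R \<inter> S) x + pair_count (R - S) x"
    unfolding pair_count_def by (rule sum.Int_Diff[OF assms(1)])
  moreover have "pair_count S x = pair_count (S \<inter> R) x + pair_count (S - R) x"
    unfolding pair_count_def by (rule sum.Int_Diff[OF assms(2)])
  ultimately show ?thesis by (simp add: Int_commute)
qed

section \<open>The largest modulus of disagreement\<close>

lemma modulus_dvd_of_difference:
  fixes m N :: int
  assumes R: "class_pairs N R" and S: "class_pairs N S" and "N > 0"
    and cong: "\<And>x. m dvd pair_count R x - pair_count S x"
    and q: "q \<in> R - S"
    and max: "\<And>q'. q' \<in> (R - S) \<union> (S - R) \<Longrightarrow> fst q' \<le> fst q"
  shows "m dvd N"
proof -
  define d where "d = fst q"
  have d: "d > 0" "d dvd N" using R q by (auto simp: d_def class_pairs_def)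
  obtain P :: "int \<Rightarrow> int" where P: "periodic d P" and P_0: "P 0 = 1"
    and P0: "\<And>p x. prime p \<Longrightarrow> p dvd d \<Longrightarrow> (\<Sum>j\<in>{0..<p}. P (x + j * (d div p))) = 0"
    using test_function_exists[OF d(1)] by blast
  have RS: "class_pairs N (R - S)" and SR: "class_pairs N (S - R)"
    by (rule class_pairs_subset[OF R], simp) (rule class_pairs_subset[OF S], simp)
  have le: "\<And>q'. q' \<in> R - S \<Longrightarrow> fst q' \<le> d" "\<And>q'. q' \<in> S - R \<Longrightarrow> fst q' \<le> d"
    using max by (auto simp: d_def)
  have pairing: "m dvd N div d * P (snd q - z)
      - (\<Sum>q'\<in>{q'\<in>S - R. fst q' = d}. N div d * P (snd q' - z))" for z
  proof -
    have "m dvd (\<Sum>x\<in>{0..<N}. (pair_count R x - pair_count S x) * P (x - z))"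
      by (intro dvd_sum dvd_mult2 cong)
    also have "\<dots> = (\<Sum>x\<in>{0..<N}. (pair_count (R - S) x - pair_count (S - R) x) * P (x - z))"
      using pair_count_diff[of R S] R S by (simp add: class_pairs_def)
    also have "\<dots> = (\<Sum>x\<in>{0..<N}. pair_count (R - S) x * P (x - z))
        - (\<Sum>x\<in>{0..<N}. pair_count (S - R) x * P (x - z))"
      by (simp add: left_diff_distrib sum_subtractf)
    also have "(\<Sum>x\<in>{0..<N}. pair_count (R - S) x * P (x - z)) = N div d * P (snd q - z)"
      using pair_count_test_function[OF RS le(1) P P0 d(1) \<open>N > 0\<close> d(2), of z]
      unfolding class_pairs_eq_modulus[OF RS q, folded d_def] by simp
    also have "(\<Sum>x\<in>{0..<N}. pair_count (S - R) x * P (x - z))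
        = (\<Sum>q'\<in>{q'\<in>S - R. fst q' = d}. N div d * P (snd q' - z))"
      by (rule pair_count_test_function[OF SR le(2) P P0 d(1) \<open>N > 0\<close> d(2)])
    finally show ?thesis .
  qed
  show ?thesis
  proof (cases "\<exists>q'\<in>S - R. fst q' = d")
    case False
    then have no: "{q'\<in>S - R. fst q' = d} = {}" by blast
    \<comment> \<open>The choice \<open>z = snd q\<close> makes the remaining value
      \<open>P 0 = 1\<close>.\<close>
    have "m dvd N div d" using pairing[of "snd q"] unfolding no by (simp add: P_0)
    then have "m dvd N div d * d" by (rule dvd_mult2)
    then show ?thesis using d(2) by simp
  next
    case True
    then obtain q' where q': "q' \<in> S - R" "fst q' = d" by blast
    define c where "c = snd q - snd q'"
    define Q where "Q y = N div d * P y" for y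
    define g where "g = gcd c d"
    \<comment> \<open>Normalised residues that agree modulo \<open>d\<close> are equal, which would
      force \<open>q = q'\<close>, although \<open>R - S\<close> and \<open>S - R\<close> are
      disjoint.\<close>
    have "\<not> d dvd c"
    proof
      assume "d dvd c"
      then have "[snd q = snd q'] (mod d)" by (simp add: c_def cong_iff_dvd_diff)
      then have "snd q = snd q'"
        using R S q q' by (auto simp: class_pairs_def d_def intro!: cong_less_imp_eq_int)
      then have "q = q'" using q'(2) by (simp add: d_def prod_eq_iff)
      then show False using q q' by blast
    qed
    then have ndvd: "\<not> d dvd g" by (simp add: g_def)
    have g: "g > 0" "g dvd d" using d(1) by (simp_all add: g_def)
    have "{q''\<in>S - R. fst q'' = d} = {q'}"
      using class_pairs_eq_modulus[OF SR q'(1)] q'(2) by simp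
    then have diff: "m dvd Q (snd q - z) - Q (snd q' - z)" for z
      using pairing[of z] by (simp add: Q_def)
    \<comment> \<open>The choice \<open>z = snd q' - y\<close> turns the two arguments into
      \<open>y + c\<close> and \<open>y\<close>.\<close>
    have "[Q (y + c) = Q y] (mod m)" for y
      using diff[of "snd q' - y"] by (simp add: c_def cong_iff_dvd_diff algebra_simps)
    moreover have "periodic d Q" using P by (auto simp: periodic_def Q_def)
    ultimately have Q_cong: "[Q x = Q 0] (mod m)" if "g dvd x" for x
      using cong_period_gcd that unfolding g_def by blast
    let ?i = "\<lambda>x. of_bool ([x = 0] (mod g)) :: int"
    \<comment> \<open>Summing over one period \<open>d\<close> keeps the final product at
      \<open>N div g\<close>, a divisor of \<open>N\<close>; a sum over \<open>{0..<N}\<close> would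
      bring in another factor \<open>N div d\<close>.\<close>
    have "(\<Sum>x\<in>{0..<d}. ?i x * P (x - 0)) = 0"
      by (rule test_function_orthogonal[OF P P0 periodic_residue_class])
        (use d g ndvd in auto)
    moreover have "(\<Sum>x\<in>{0..<d}. ?i x * Q x) = N div d * (\<Sum>x\<in>{0..<d}. ?i x * P (x - 0))"
      unfolding Q_def sum_distrib_left by (intro sum.cong refl) simp
    \<comment> \<open>\<open>Q\<close> is constant modulo \<open>m\<close> on the multiples of
      \<open>g\<close>, so the vanishing sum is congruent to their number times
      \<open>Q 0\<close>.\<close>
    ultimately have "0 = (\<Sum>x\<in>{0..<d}. ?i x * Q x)" by simp
    also have "[\<dots> = (\<Sum>x\<in>{0..<d}. ?i x * Q 0)] (mod m)"
      using Q_cong by (intro cong_sum) (auto simp: cong_0_iff)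
    also have "(\<Sum>x\<in>{0..<d}. ?i x * Q 0) = (d div g) * Q 0"
      using count_residue_class[OF g(1) d(1) g(2), of 0] by (simp only: sum_distrib_right[symmetric])
    also have "\<dots> = d div g * (N div d)" by (simp add: Q_def P_0)
    finally have "m dvd d div g * (N div d)" by (simp add: cong_sym_eq[of 0] cong_0_iff)
    moreover have "d div g * (N div d) dvd N"
      using d(1,2) g by (elim dvdE) simp
    ultimately show ?thesis by (rule dvd_trans)
  qed
qed

lemma class_pairs_unique:
  fixes m N :: int
  assumes R: "class_pairs N R" and S: "class_pairs N S" and "N > 0"
    and cong: "\<And>x. m dvd pair_count R x - pair_count S x" and "\<not> m dvd N"
  shows "R = S"
proof (rule ccontr)
  let ?D = "(R - S) \<union> (S - R)"
  assume "R \<noteq> S"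
  then have "finite (fst ` ?D)" "fst ` ?D \<noteq> {}"
    using R S by (auto simp: class_pairs_def)
  then have "Max (fst ` ?D) \<in> fst ` ?D" by (rule Max_in)
  then obtain q where q: "q \<in> ?D" "fst q = Max (fst ` ?D)"
    by (metis imageE)
  then have max: "fst q' \<le> fst q" if "q' \<in> ?D" for q'
    using that \<open>finite (fst ` ?D)\<close> by simp
  \<comment> \<open>The situation is symmetric up to sign, so whichever system contains
    \<open>q\<close> can come first.\<close>
  have cong': "m dvd pair_count S x - pair_count R x" for x
    using cong[of x] by (simp add: dvd_diff_commute)
  from q(1) have "m dvd N"
  proof
    assume "q \<in> R - S"
    then show ?thesis by (rule modulus_dvd_of_difference[OF R S \<open>N > 0\<close> cong]) (rule max)
  next
    assume "q \<in> S - R"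
    then show ?thesis
      by (rule modulus_dvd_of_difference[OF S R \<open>N > 0\<close> cong']) (use max in blast)
  qed
  then show False using \<open>\<not> m dvd N\<close> by blast
qed

section \<open>Back to indexed systems\<close>

definition pairs_of :: "nat \<Rightarrow> (nat \<Rightarrow> int) \<Rightarrow> (nat \<Rightarrow> int) \<Rightarrow> (int \<times> int) set" where
  "pairs_of k a n = (\<lambda>s. (n s, a s mod n s)) ` {1..k}"

lemma inj_on_pairs: "inj_on n A \<Longrightarrow> inj_on (\<lambda>s. (n s, a s mod n s)) A"
  by (auto simp: inj_on_def)

text \<open>Distinct moduli keep the pairs distinct, so the set of pairs determines the length of
  the system.\<close>

lemma card_pairs_of: "inj_on n {1..k} \<Longrightarrow> card (pairs_of k a n) = k"
  unfolding pairs_of_def by (subst card_image[OF inj_on_pairs]) simp_all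

lemma class_pairs_pairs_of:
  assumes "inj_on n {1..k}" and "\<And>s. s \<in> {1..k} \<Longrightarrow> n s > 0"
    and "\<And>s. s \<in> {1..k} \<Longrightarrow> n s dvd N"
  shows "class_pairs N (pairs_of k a n)"
  unfolding class_pairs_def
proof (intro conjI ballI)
  show "inj_on fst (pairs_of k a n)"
    unfolding pairs_of_def by (rule inj_on_imageI) (use assms(1) in \<open>simp add: o_def\<close>)
next
  fix q assume "q \<in> pairs_of k a n"
  then obtain s where "s \<in> {1..k}" "q = (n s, a s mod n s)"
    unfolding pairs_of_def by (rule imageE)
  then show "fst q > 0" "fst q dvd N" "0 \<le> snd q" "snd q < fst q"
    using assms(2)[of s] assms(3)[of s] by simp_all
qed (simp add: pairs_of_def)

lemma pair_count_pairs_of: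
  assumes "inj_on n {1..k}"
  shows "pair_count (pairs_of k a n) x = int (covering_function k a n x)"
proof -
  have "pair_count (pairs_of k a n) x = (\<Sum>s\<in>{1..k}. of_bool ([x = a s] (mod n s)))"
    unfolding pair_count_def pairs_of_def
    by (subst sum.reindex[OF inj_on_pairs[OF assms]]) (simp add: o_def cong_def)
  also have "\<dots> = int (covering_function k a n x)"
    by (simp flip: sum.inter_filter add: of_bool_def covering_function_def)
  finally show ?thesis .
qed

text \<open>Reducing a residue does not change its class, so equal sets of pairs yield equal sets of
  classes.\<close>

lemma class_set_pairs_of: "class_set k a n = (\<lambda>(d, r). residue_class r d) ` pairs_of k a n"
  by (simp add: class_set_def pairs_of_def image_image residue_class_def cong_def)

theorem theorem1p2:
  fixes k l :: nat
    and a b n m :: "nat \<Rightarrow> int"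
    and N d :: int
  assumes "k > 0" and "l > 0"
    and "\<And>s. s \<in> {1..k} \<Longrightarrow> n s > 0"
    and "\<And>t. t \<in> {1..l} \<Longrightarrow> m t > 0"
    and "inj_on n {1..k}"
    and "inj_on m {1..l}"
    and "N = Lcm (n ` {1..k} \<union> m ` {1..l})"
    and "\<not> d dvd N"
    and "\<And>x :: int. [int (covering_function k a n x) = int (covering_function l b m x)] (mod d)"
  shows "k = l \<and> class_set k a n = class_set l b m"
proof -
  have "0 \<notin> n ` {1..k} \<union> m ` {1..l}" using assms(3,4) by fastforce
  \<comment> \<open>A finite set has \<open>Lcm\<close> zero only if it contains
    \<open>0\<close>.\<close>
  then have "N \<noteq> 0" by (simp add: assms(7) Lcm_0_iff)
  then have "N > 0" using Lcm_int_greater_eq_0[of "n ` {1..k} \<union> m ` {1..l}"] assms(7) by linarith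
  have "n s dvd N" if "s \<in> {1..k}" for s
    unfolding assms(7) by (rule dvd_Lcm) (use that in blast)
  then have R: "class_pairs N (pairs_of k a n)"
    using assms(3,5) by (intro class_pairs_pairs_of)
  have "m t dvd N" if "t \<in> {1..l}" for t
    unfolding assms(7) by (rule dvd_Lcm) (use that in blast)
  then have S: "class_pairs N (pairs_of l b m)"
    using assms(4,6) by (intro class_pairs_pairs_of)
  \<comment> \<open>This includes \<open>d = 0\<close>, where congruence and divisibility both
    express equality of the two counts.\<close>
  have "d dvd pair_count (pairs_of k a n) x - pair_count (pairs_of l b m) x" for x
    using assms(9)[of x]
    unfolding pair_count_pairs_of[OF assms(5)] pair_count_pairs_of[OF assms(6)]
    by (simp add: cong_iff_dvd_diff)
  then have eq: "pairs_of k a n = pairs_of l b m"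
    by (rule class_pairs_unique[OF R S \<open>N > 0\<close> _ assms(8)])
  then show ?thesis
    using card_pairs_of[OF assms(5), of a] card_pairs_of[OF assms(6), of b]
    by (simp add: class_set_pairs_of)
qed

end
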